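(* Let $I$ be a uniform normal ideal on a cardinal $\kappa$. Suppose that the poset $\mathcal P(\kappa)/I$ is $I^n$-$m$-linked for all $n,m\in\omega$. Then $\mathrm{PH}_n(\kappa)$ holds for all $n\in\omega$.
   Context: All ideals are proper ($\kappa\notin I$) and uniform ($[\kappa]^{<\kappa}\subseteq I$); $I^*$ is the dual filter, $I^+$ the positive sets; normality is in the usual sense. $\mathcal P(\kappa)/I$ is the poset of $I$-positive subsets of $\kappa$ ordered by inclusion (so finitely many elements have a common lower bound iff their intersection is $I$-positive). For $n\ge1$, $[\kappa]^n$ is the set of strictly increasing $n$-tuples from $\kappa$, identified with $n$-element subsets; $[\kappa]^{\le n}$ is the set of subsets of $\kappa$ of size at most $n$. Fubini powers: $I^0=\{\emptyset\}$ on $[\kappa]^0=\{\emptyset\}$, $I^1=I$, and for $n\ge2$, $X\subseteq[\kappa]^n$ is in $I^n$ iff $\{\alpha:\{\bar\beta\in[\kappa]^{n-1}:(\alpha,\bar\beta)\in X\}\in I^{n-1}\}\in I^*$; $(I^n)^+$ denotes the $I^n$-positive sets. For $a,b\in[\kappa]^n$, $a\simeq b$ means the order-preserving bijection from $a$ onto $b$ is the identity on $a\cap b$. A poset $P$ is $I^n$-$m$-linked if for every $X\in(I^n)^+$ and every $\langle p_a\in P:a\in X\rangle$ there is $Y\subseteq X$ with $Y\in(I^n)^+$ such that whenever $k\le m$ and $a_0,\dots,a_{k-1}\in Y$ are pairwise $\simeq$, the conditions $p_{a_0},\dots,p_{a_{k-1}}$ have a common lower bound. A function $F:[\kappa]^{\le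 n}\to\kappa$ is cofinal if $\alpha<F(\{\alpha\})$ for every $\alpha<\kappa$ and $F(x)<F(y)$ whenever $x\subsetneq y$. $[\kappa]^{[n]}$ is the set of sequences $\sigma=\langle\sigma(i):i<n\rangle$ with $\sigma(i)\in[\kappa]^{i+1}$ and $\sigma(i)\subseteq\sigma(i+1)$ for all $i<n-1$. Given $F:[\kappa]^{\le n}\to\kappa$, $F^*:[\kappa]^{[n]}\to[\kappa]^n$ is $F^*(\sigma)=\{F(\sigma(i)):i<n\}$. $\mathrm{PH}_n(\kappa)$ is the statement: for every $c:[\kappa]^{n+1}\to\omega$ there is a cofinal $F:[\kappa]^{\le n+1}\to\kappa$ such that $c\circ F^*$ (with $F^*$ defined on $[\kappa]^{[n+1]}$) is constant. *)

theory Defs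
  imports "HOL-Library.Ramsey" "HOL-Library.FuncSet"
begin

unbundle cardinal_syntax

text \<open>
  A cardinal \<open>\<kappa>\<close> is a relation \<open>r\<close> with \<open>Card_order r\<close>; the ordinals below \<open>\<kappa>\<close> are the
  elements of \<open>Field r\<close>, and \<open>[\<kappa>]^n\<close> is \<open>nsets (Field r) n\<close>.
  The relation \<open>r\<close> itself is reflexive.
\<close>

abbreviation less_in :: "'a rel \<Rightarrow> 'a \<Rightarrow> 'a \<Rightarrow> bool" where
  "less_in r x y \<equiv> x \<in> underS r y"

definition nsets_le :: "'a set \<Rightarrow> nat \<Rightarrow> 'a set set" where
  "nsets_le A n = {x. x \<subseteq> A \<and> finite x \<and> card x \<le> n}"

subsection \<open>Ideals and their Fubini powers\<close>

definition proper_ideal_on :: "'a set \<Rightarrow> 'a set set \<Rightarrow> bool" where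
  "proper_ideal_on A I \<longleftrightarrow>
     I \<subseteq> Pow A \<and> {} \<in> I \<and>
     (\<forall>X\<in>I. \<forall>Y. Y \<subseteq> X \<longrightarrow> Y \<in> I) \<and>
     (\<forall>X\<in>I. \<forall>Y\<in>I. X \<union> Y \<in> I) \<and>
     A \<notin> I"

definition uniform_ideal :: "'a rel \<Rightarrow> 'a set set \<Rightarrow> bool" where
  "uniform_ideal r I \<longleftrightarrow> (\<forall>X. X \<subseteq> Field r \<and> |X| <o r \<longrightarrow> X \<in> I)"

text \<open>Normality is closure under diagonal unions.\<close>

definition normal_ideal :: "'a rel \<Rightarrow> 'a set set \<Rightarrow> bool" where
  "normal_ideal r I \<longleftrightarrow>
     (\<forall>X. (\<forall>\<alpha>\<in>Field r. X \<alpha> \<in> I) \<longrightarrow> {\<beta> \<in> Field r. \<exists>\<alpha>. less_in r \<alpha> \<beta> \<and> \<beta> \<in> X \<alpha>} \<in> I)"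

definition positive_sets :: "'b set \<Rightarrow> 'b set set \<Rightarrow> 'b set set" where
  "positive_sets S J = {X. X \<subseteq> S \<and> X \<notin> J}"

definition dual_filter :: "'b set \<Rightarrow> 'b set set \<Rightarrow> 'b set set" where
  "dual_filter S J = {X. X \<subseteq> S \<and> S - X \<in> J}"

text \<open>
  The tuple \<open>(\<alpha>, b)\<close> with \<open>\<alpha>\<close> below all elements of \<open>b\<close> is identified with the set
  \<open>insert \<alpha> b\<close>; in particular the \<open>1\<close>-tuple of \<open>\<alpha>\<close> is \<open>{\<alpha>}\<close>.
\<close>

fun fubini_power :: "'a rel \<Rightarrow> 'a set set \<Rightarrow> nat \<Rightarrow> 'a set set set" where
  "fubini_power r I 0 = {{}}"
| "fubini_power r I (Suc 0) =
     {X. X \<subseteq> nsets (Field r) 1 \<and> {\<alpha> \<in> Field r. {\<alpha>} \<in> X} \<in> I}"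
| "fubini_power r I (Suc (Suc n)) =
     {X. X \<subseteq> nsets (Field r) (Suc (Suc n)) \<and>
         {\<alpha> \<in> Field r.
            {b \<in> nsets (Field r) (Suc n). (\<forall>\<beta>\<in>b. less_in r \<alpha> \<beta>) \<and> insert \<alpha> b \<in> X}
              \<in> fubini_power r I (Suc n)}
         \<in> dual_filter (Field r) I}"

subsection \<open>Linkedness\<close>

definition same_type :: "'a rel \<Rightarrow> 'a set \<Rightarrow> 'a set \<Rightarrow> bool" where
  "same_type r a b \<longleftrightarrow>
     (\<exists>f. bij_betw f a b \<and> monotone_on a (less_in r) (less_in r) f \<and> (\<forall>x\<in>a \<inter> b. f x = x))"

text \<open>The poset has carrier \<open>P\<close> and order \<open>le\<close>.\<close>

definition linked ::
    "'a rel \<Rightarrow> 'a set set \<Rightarrow> nat \<Rightarrow> nat \<Rightarrow> 'p set \<Rightarrow> ('p \<Rightarrow> 'p \<Rightarrow> bool) \<Rightarrow> bool" where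
  "linked r I n m P le \<longleftrightarrow>
     (\<forall>X \<in> positive_sets (nsets (Field r) n) (fubini_power r I n).
      \<forall>p \<in> X \<rightarrow> P.
      \<exists>Y \<in> positive_sets (nsets (Field r) n) (fubini_power r I n).
        Y \<subseteq> X \<and>
        (\<forall>k\<le>m. \<forall>a :: nat \<Rightarrow> 'a set.
           (\<forall>i<k. a i \<in> Y) \<and> (\<forall>i<k. \<forall>j<k. same_type r (a i) (a j)) \<longrightarrow>
           (\<exists>q\<in>P. \<forall>i<k. le q (p (a i)))))"

subsection \<open>The partition hypothesis\<close>

definition cofinal_fun :: "'a rel \<Rightarrow> nat \<Rightarrow> ('a set \<Rightarrow> 'a) \<Rightarrow> bool" where
  "cofinal_fun r n F \<longleftrightarrow>
     F \<in> nsets_le (Field r) n \<rightarrow> Field r \<and>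
     (\<forall>\<alpha>\<in>Field r. less_in r \<alpha> (F {\<alpha>})) \<and>
     (\<forall>x \<in> nsets_le (Field r) n. \<forall>y \<in> nsets_le (Field r) n.
        x \<subset> y \<longrightarrow> less_in r (F x) (F y))"

definition flags :: "'a set \<Rightarrow> nat \<Rightarrow> 'a set list set" where
  "flags A n =
     {\<sigma>. length \<sigma> = n \<and> (\<forall>i<n. \<sigma> ! i \<in> nsets A (i + 1)) \<and>
         (\<forall>i. Suc i < n \<longrightarrow> \<sigma> ! i \<subseteq> \<sigma> ! Suc i)}"

definition star :: "('a set \<Rightarrow> 'a) \<Rightarrow> 'a set list \<Rightarrow> 'a set" where
  "star F \<sigma> = {F (\<sigma> ! i) | i. i < length \<sigma>}"

text \<open>
  A colouring is a total function, but for cofinal \<open>F\<close> only its values on \<open>[\<kappa>]^(n+1)\<close> matter,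
  since \<open>star F\<close> takes its values there.
\<close>

definition PH :: "nat \<Rightarrow> 'a rel \<Rightarrow> bool" where
  "PH n r \<longleftrightarrow>
     (\<forall>c :: 'a set \<Rightarrow> nat. \<exists>F. cofinal_fun r (n + 1) F \<and>
        (\<exists>d. \<forall>\<sigma> \<in> flags (Field r) (n + 1). c (star F \<sigma>) = d))"

end

theory Submission
  imports Defs
begin

text \<open>
  Write \<open>(I^n)\<^sup>+\<close> for the \<open>I^n\<close>-positive sets. A normal uniform ideal is countably complete, hence
  so is every \<open>I^n\<close>, and some colour class \<open>X\<close> of \<open>c\<close> lies in \<open>(I^(n+1))\<^sup>+\<close>. Start from
  \<open>Y\<^sub>n\<^sub>+\<^sub>1 = X\<close>; given \<open>Y\<^sub>i\<^sub>+\<^sub>1\<close>, the set of all \<open>a\<close> with \<open>p\<^sub>a = {\<gamma> > a. a \<union> {\<gamma>} \<in> Y\<^sub>i\<^sub>+\<^sub>1}\<close> positive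
  lies in \<open>(I^i)\<^sup>+\<close>, and linkedness shrinks it to \<open>Y\<^sub>i\<close> such that, for boundedly many pairwise \<open>\<simeq>\<close>
  elements \<open>a\<close> of \<open>Y\<^sub>i\<close>, the sets \<open>p\<^sub>a\<close> have a positive common subset. Now choose \<open>F(x)\<close> by
  recursion on \<open>(max x, |x|)\<close>, above all previous values, in the intersection of the \<open>p\<^sub>a\<close> for
  \<open>a = F\<^sup>*(\<sigma>)\<close>, where \<open>\<sigma>\<close> ranges over the maximal flags of proper subsets of \<open>x\<close>. These \<open>a\<close> are
  pairwise \<open>\<simeq>\<close>, since the recursion makes \<open>F(u)\<close> and \<open>F(v)\<close> distinct whenever \<open>|u|\<close> and \<open>|v|\<close> are.
  By construction \<open>F\<^sup>*\<close> maps flags of length \<open>i\<close> into \<open>Y\<^sub>i\<close>.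
\<close>

section \<open>The well-order of the cardinal\<close>

locale normal_uniform_ideal =
  fixes r :: "'a rel" and I :: "'a set set"
  assumes Card_order: "Card_order r"
    and infinite_Field: "infinite (Field r)"
    and proper: "proper_ideal_on (Field r) I"
    and uniform: "uniform_ideal r I"
    and normal: "normal_ideal r I"
begin

lemma Well_order: "Well_order r"
  using Card_order card_order_on_well_order_on by blast

lemma wf_strict: "wf (r - Id)"
  using Well_order by (simp add: well_order_on_def)

lemma wo_rel: "wo_rel r"
  using Well_order by (simp add: wo_rel_def)

lemma less_in_trans: "less_in r a b \<Longrightarrow> less_in r b c \<Longrightarrow> less_in r a c"
  using wo_rel.TRANS[OF wo_rel] wo_rel.ANTISYM[OF wo_rel]
  unfolding underS_def trans_def antisym_def by blast

lemma less_in_asym: "less_in r a b \<Longrightarrow> \<not> less_in r b a"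
  using wo_rel.ANTISYM[OF wo_rel] unfolding underS_def antisym_def by blast

lemma less_in_total: "a \<in> Field r \<Longrightarrow> b \<in> Field r \<Longrightarrow> a = b \<or> less_in r a b \<or> less_in r b a"
  using wo_rel.TOTALS[OF wo_rel] unfolding underS_def by blast

lemma less_in_Field: "less_in r a b \<Longrightarrow> a \<in> Field r" "less_in r a b \<Longrightarrow> b \<in> Field r"
  unfolding underS_def Field_def by blast+

lemma rel_refl: "a \<in> Field r \<Longrightarrow> (a, a) \<in> r"
  using wo_rel.REFL[OF wo_rel] by (auto simp: refl_on_def)

lemma ex_max:
  assumes "finite S" "S \<noteq> {}" "S \<subseteq> Field r"
  shows "\<exists>a\<in>S. \<forall>z\<in>S. (z, a) \<in> r"
  using assms
proof (induction S)
  case (insert x S)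
  show ?case
  proof (cases "S = {}")
    case False
    then obtain a where a: "a \<in> S" "\<forall>z\<in>S. (z, a) \<in> r" using insert by auto
    have "x \<in> Field r" "a \<in> Field r" using insert.prems a by auto
    then consider "(x, a) \<in> r" | "(a, x) \<in> r" "(x, x) \<in> r"
      using wo_rel.TOTALS[OF wo_rel] rel_refl by blast
    then show ?thesis
    proof cases
      case 2
      then have "\<forall>z\<in>insert x S. (z, x) \<in> r"
        using a(2) wo_rel.TRANS[OF wo_rel] by (blast dest: transD)
      then show ?thesis by blast
    qed (use a in blast)
  qed (use insert rel_refl in auto)
qed simp

definition least_el :: 'a where
  "least_el = wo_rel.minim r (Field r)"

lemma least_el: "least_el \<in> Field r" "b \<in> Field r \<Longrightarrow> (least_el, b) \<in> r"
proof -
  have "Field r \<noteq> {}" using infinite_Field by auto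
  then show "least_el \<in> Field r" "b \<in> Field r \<Longrightarrow> (least_el, b) \<in> r"
    using wo_rel.minim_inField[OF wo_rel, of "Field r"] wo_rel.minim_least[OF wo_rel, of "Field r"]
    by (auto simp: least_el_def)
qed

section \<open>Completeness of normal uniform ideals\<close>

lemma ideal_subset: "X \<in> I \<Longrightarrow> Y \<subseteq> X \<Longrightarrow> Y \<in> I"
  and ideal_Un: "X \<in> I \<Longrightarrow> Y \<in> I \<Longrightarrow> X \<union> Y \<in> I"
  and ideal_empty: "{} \<in> I"
  and Field_notin_ideal: "Field r \<notin> I"
  and ideal_le_Field: "X \<in> I \<Longrightarrow> X \<subseteq> Field r"
  using proper unfolding proper_ideal_on_def by blast+

lemma finite_in: "finite X \<Longrightarrow> X \<subseteq> Field r \<Longrightarrow> X \<in> I"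
proof -
  assume "finite X" "X \<subseteq> Field r"
  moreover from this have "|X| <o r"
    using Card_order infinite_Field
    by (metis finite_ordLess_infinite card_of_Field_ordIso card_of_Well_order card_of_card_order_on
        Field_card_of Well_order)
  ultimately show "X \<in> I" using uniform unfolding uniform_ideal_def by blast
qed

lemma underS_in: "a \<in> Field r \<Longrightarrow> underS r a \<in> I"
  using uniform card_of_underS[OF Card_order] less_in_Field(1) unfolding uniform_ideal_def by blast

lemma under_in:
  assumes "a \<in> Field r" shows "under r a \<in> I"
proof -
  have "under r a \<subseteq> underS r a \<union> {a}" by (auto simp: under_def underS_def)
  then show ?thesis
    using ideal_Un[OF underS_in[OF assms] finite_in[of "{a}"]] assms ideal_subset by blast
qed

text \<open>Points of \<open>X b\<close> above \<open>b\<close> fall into a diagonal union, which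
  normality puts in \<open>I\<close>. All other points are at most \<open>b\<close>, hence in
  \<open>under r a\<close>, which is small by uniformity.\<close>

lemma UN_under:
  assumes "a \<in> Field r" and "\<And>b. (b, a) \<in> r \<Longrightarrow> X b \<in> I"
  shows "(\<Union>b\<in>under r a. X b) \<in> I"
proof -
  \<comment> \<open>Normality speaks of families over the whole field, so indices beyond
    \<open>a\<close> get the empty set.\<close>
  define Z where "Z b = (if (b, a) \<in> r then X b else {})" for b
  have Z: "Z b \<in> I" for b using assms ideal_empty by (auto simp: Z_def)
  let ?D = "{\<beta> \<in> Field r. \<exists>\<alpha>. less_in r \<alpha> \<beta> \<and> \<beta> \<in> Z \<alpha>}"
  have D: "?D \<in> I"
    using normal Z unfolding normal_ideal_def by blast
  have "(\<Union>b\<in>under r a. X b) \<subseteq> ?D \<union> under r a"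
  proof
    fix x assume "x \<in> (\<Union>b\<in>under r a. X b)"
    then obtain b where b: "(b, a) \<in> r" "x \<in> X b" by (auto simp: under_def)
    then have x: "x \<in> Field r" using ideal_le_Field assms(2) by blast
    have bF: "b \<in> Field r" using b FieldI1 by metis
    consider "b = x" | "less_in r b x" | "less_in r x b" using less_in_total[OF bF x] by blast
    then show "x \<in> ?D \<union> under r a"
    proof cases
      case 2 then show ?thesis using b x by (auto simp: Z_def)
    next
      case 3
      then show ?thesis using b wo_rel.TRANS[OF wo_rel]
        by (auto simp: under_def underS_def trans_def)
    qed (use b in \<open>auto simp: under_def\<close>)
  qed
  then show ?thesis using ideal_Un[OF D under_in[OF assms(1)]] ideal_subset by blast
qed

text \<open>
  If all proper initial segments were finite, every element but the least would be an immediate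
  successor, and \<open>Field r\<close> would be a diagonal union of singletons up to one point.
\<close>

lemma ex_infinite_under: "\<exists>a\<in>Field r. infinite (under r a)"
proof (rule ccontr)
  assume "\<not> ?thesis"
  then have fin: "finite (underS r b)" if "b \<in> Field r" for b
    using that by (meson finite_subset underS_subset_under)
  define X where "X a = {b \<in> Field r. less_in r a b \<and> (\<forall>z. less_in r z b \<longrightarrow> (z, a) \<in> r)}" for a
  have "X a \<in> I" for a
  proof (rule finite_in)
    have "b = c" if "b \<in> X a" "c \<in> X a" for b c
    proof (rule ccontr)
      assume "b \<noteq> c"
      moreover have "b \<in> Field r" "c \<in> Field r" using that by (auto simp: X_def)
      ultimately have "less_in r b c \<or> less_in r c b" using less_in_total by blast
      then show False
      proof
        assume "less_in r b c"
        then have "(b, a) \<in> r" "less_in r a b" using that by (auto simp: X_def)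
        then show False using less_in_asym by (auto simp: underS_def)
      next
        assume "less_in r c b"
        then have "(c, a) \<in> r" "less_in r a c" using that by (auto simp: X_def)
        then show False using less_in_asym by (auto simp: underS_def)
      qed
    qed
    then show "finite (X a)"
      by (metis finite.emptyI finite_insert finite_subset insertI1 subsetI ex_in_conv)
  qed (auto simp: X_def)
  then have D: "{\<beta> \<in> Field r. \<exists>\<alpha>. less_in r \<alpha> \<beta> \<and> \<beta> \<in> X \<alpha>} \<in> I"
    using normal unfolding normal_ideal_def by blast
  have "b \<in> {\<beta> \<in> Field r. \<exists>\<alpha>. less_in r \<alpha> \<beta> \<and> \<beta> \<in> X \<alpha>} \<union> {least_el}" if b: "b \<in> Field r" for b
  proof (cases "b = least_el")
    case False
    have "least_el \<in> underS r b" using False least_el b by (auto simp: underS_def)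
    then obtain a where "a \<in> underS r b" "\<forall>z\<in>underS r b. (z, a) \<in> r"
      using ex_max[OF fin[OF b]] less_in_Field(1) by blast
    then have "less_in r a b \<and> b \<in> X a" using b by (auto simp: X_def)
    then show ?thesis using b by blast
  qed simp
  then have "Field r \<subseteq> {\<beta> \<in> Field r. \<exists>\<alpha>. less_in r \<alpha> \<beta> \<and> \<beta> \<in> X \<alpha>} \<union> {least_el}" by blast
  moreover have "{least_el} \<in> I" using least_el by (auto intro: finite_in)
  ultimately show False using Field_notin_ideal ideal_subset ideal_Un[OF D] by blast
qed

text \<open>An infinite initial segment contains a copy of the natural numbers, so the union can be
  reindexed along it. Indices outside the copy repeat some \<open>X k\<close>, which is
  harmless.\<close>

lemma UN_nat:
  fixes X :: "nat \<Rightarrow> 'a set"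
  assumes "\<And>k. X k \<in> I"
  shows "(\<Union>k. X k) \<in> I"
proof -
  obtain a where a: "a \<in> Field r" "infinite (under r a)" using ex_infinite_under by blast
  then obtain f :: "nat \<Rightarrow> 'a" where f: "inj f" "range f \<subseteq> under r a"
    using infinite_countable_subset by blast
  have "(\<Union>b\<in>under r a. X (inv f b)) \<in> I" by (rule UN_under[OF a(1) assms])
  moreover have "(\<Union>k. X k) \<subseteq> (\<Union>b\<in>under r a. X (inv f b))"
  proof
    fix x assume "x \<in> (\<Union>k. X k)"
    then obtain k where "x \<in> X (inv f (f k))" using f(1) by auto
    moreover have "f k \<in> under r a" using f(2) by blast
    ultimately show "x \<in> (\<Union>b\<in>under r a. X (inv f b))" by blast
  qed
  ultimately show ?thesis using ideal_subset by blast
qed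

text \<open>Iterates \<open>UN_under\<close>, splitting off one element of \<open>y\<close> at a
  time. It later serves to bound the values of F at all sets that precede a given set in the
  recursion.\<close>

lemma UN_nsets_le:
  assumes a: "a \<in> Field r" and "\<And>y. y \<in> nsets_le (under r a) k \<Longrightarrow> X y \<in> I"
  shows "(\<Union>y\<in>nsets_le (under r a) k. X y) \<in> I"
  using assms(2)
proof (induction k arbitrary: X)
  case 0
  have "nsets_le (under r a) 0 = {{}}" by (auto simp: nsets_le_def)
  then show ?case using 0 by simp
next
  case (Suc k)
  have ins: "insert b y \<in> nsets_le (under r a) (Suc k)"
    if "(b, a) \<in> r" "y \<in> nsets_le (under r a) k" for b y
    using that card_insert_le_m1[of "Suc k" y b] by (auto simp: nsets_le_def under_def)
  have "(\<Union>b\<in>under r a. \<Union>y\<in>nsets_le (under r a) k. X (insert b y)) \<in> I"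
    by (intro UN_under a Suc.IH Suc.prems ins)
  moreover have "X {} \<in> I" using Suc.prems by (auto simp: nsets_le_def)
  moreover have "(\<Union>y\<in>nsets_le (under r a) (Suc k). X y)
      \<subseteq> (\<Union>b\<in>under r a. \<Union>y\<in>nsets_le (under r a) k. X (insert b y)) \<union> X {}"
  proof
    fix x assume "x \<in> (\<Union>y\<in>nsets_le (under r a) (Suc k). X y)"
    then obtain y where y: "y \<in> nsets_le (under r a) (Suc k)" "x \<in> X y" by blast
    show "x \<in> (\<Union>b\<in>under r a. \<Union>y\<in>nsets_le (under r a) k. X (insert b y)) \<union> X {}"
    proof (cases "y = {}")
      case False
      then obtain b where "b \<in> y" by blast
      then have "b \<in> under r a" "y - {b} \<in> nsets_le (under r a) k" "insert b (y - {b}) = y"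
        using y by (auto simp: nsets_le_def card_Diff_singleton)
      then show ?thesis using y(2) by fastforce
    qed (use y in auto)
  qed
  ultimately show ?case using ideal_Un ideal_subset by meson
qed

section \<open>Positive sets of the Fubini powers\<close>

definition pos :: "nat \<Rightarrow> 'a set set set" where
  "pos n = positive_sets (nsets (Field r) n) (fubini_power r I n)"

definition slice :: "nat \<Rightarrow> 'a set set \<Rightarrow> 'a \<Rightarrow> 'a set set" where
  "slice n X \<alpha> = {b \<in> nsets (Field r) n. (\<forall>\<beta>\<in>b. less_in r \<alpha> \<beta>) \<and> insert \<alpha> b \<in> X}"

text \<open>The section in the last coordinate, where \<open>slice\<close> is the section in the
  first. These sections are the conditions to which linkedness is applied.\<close>

definition extensions :: "'a set set \<Rightarrow> 'a set \<Rightarrow> 'a set" where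
  "extensions X a = {\<gamma> \<in> Field r. (\<forall>\<beta>\<in>a. less_in r \<beta> \<gamma>) \<and> insert \<gamma> a \<in> X}"

lemma nsets_0: "nsets (Field r) 0 = {{}}"
  by (auto simp: nsets_def)

lemma pos_0: "X \<in> pos 0 \<longleftrightarrow> X = {{}}"
  by (auto simp: pos_def positive_sets_def nsets_0)

text \<open>Merges the two successor clauses of \<open>fubini_power\<close>: the complement of the
  set of points with small slice is the set of points with positive slice. The inductions on
  positive sets rest on this and \<open>pos_0\<close>.\<close>

lemma pos_Suc:
  "X \<in> pos (Suc n) \<longleftrightarrow>
     X \<subseteq> nsets (Field r) (Suc n) \<and> {\<alpha> \<in> Field r. slice n X \<alpha> \<in> pos n} \<notin> I"
proof (cases n)
  case 0
  have "{\<alpha> \<in> Field r. slice 0 X \<alpha> \<in> pos 0} = {\<alpha> \<in> Field r. {\<alpha>} \<in> X}"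
    by (auto simp: slice_def pos_0 nsets_0)
  then show ?thesis by (auto simp: 0 pos_def positive_sets_def)
next
  case (Suc k)
  have "Field r - {\<alpha> \<in> Field r. slice n X \<alpha> \<in> fubini_power r I n}
      = {\<alpha> \<in> Field r. slice n X \<alpha> \<in> pos n}"
    by (auto simp: pos_def positive_sets_def slice_def)
  then show ?thesis
    by (auto simp: Suc pos_def positive_sets_def dual_filter_def slice_def)
qed

text \<open>Countable completeness of the Fubini powers. By induction a positive slice of
  \<open>X\<close> yields a positive slice of some \<open>Z k\<close>; were no \<open>Z k\<close>
  positive, the points with such slices would form a countable union of sets in
  \<open>I\<close>.\<close>

lemma pos_countable_cover:
  assumes "X \<in> pos n" "X \<subseteq> (\<Union>k::nat. Z k)" "\<And>k. Z k \<subseteq> nsets (Field r) n"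
  shows "\<exists>k. Z k \<in> pos n"
  using assms
proof (induction n arbitrary: X Z)
  case 0
  then obtain k where "{} \<in> Z k" by (auto simp: pos_0)
  then have "Z k = {{}}" using 0(3)[of k] by (auto simp: nsets_0)
  then show ?case by (auto simp: pos_0)
next
  case (Suc n)
  show ?case
  proof (rule ccontr)
    assume "\<nexists>k. Z k \<in> pos (Suc n)"
    then have "{\<alpha> \<in> Field r. slice n (Z k) \<alpha> \<in> pos n} \<in> I" for k
      using Suc.prems(3) pos_Suc by blast
    then have U: "(\<Union>k. {\<alpha> \<in> Field r. slice n (Z k) \<alpha> \<in> pos n}) \<in> I" by (rule UN_nat)
    have "\<exists>k. slice n (Z k) \<alpha> \<in> pos n" if "slice n X \<alpha> \<in> pos n" for \<alpha>
    proof (rule Suc.IH[OF that])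
      show "slice n X \<alpha> \<subseteq> (\<Union>k. slice n (Z k) \<alpha>)" using Suc.prems(2) by (auto simp: slice_def)
    qed (auto simp: slice_def)
    then have "{\<alpha> \<in> Field r. slice n X \<alpha> \<in> pos n} \<subseteq> (\<Union>k. {\<alpha> \<in> Field r. slice n (Z k) \<alpha> \<in> pos n})"
      by blast
    then show False using Suc.prems(1) ideal_subset[OF U] pos_Suc by blast
  qed
qed

lemma pos_mono: "X \<in> pos n \<Longrightarrow> X \<subseteq> Z \<Longrightarrow> Z \<subseteq> nsets (Field r) n \<Longrightarrow> Z \<in> pos n"
  using pos_countable_cover[of X n "\<lambda>_. Z"] by auto

lemma underS_compl_notin:
  assumes "a \<in> Field r" shows "{b. less_in r a b} \<notin> I"
proof
  assume "{b. less_in r a b} \<in> I"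
  moreover have "Field r \<subseteq> {b. less_in r a b} \<union> under r a"
    using less_in_total[OF _ assms] rel_refl[OF assms] by (auto simp: under_def underS_def)
  ultimately show False using ideal_Un under_in[OF assms] ideal_subset Field_notin_ideal by blast
qed

text \<open>The lower bound is there for the induction: the slice at a point above \<alpha> contains
  all \<open>n\<close>-sets above that point.\<close>

lemma nsets_above_pos:
  "\<alpha> \<in> Field r \<Longrightarrow> {b \<in> nsets (Field r) n. \<forall>\<beta>\<in>b. less_in r \<alpha> \<beta>} \<in> pos n"
proof (induction n arbitrary: \<alpha>)
  case 0
  then show ?case by (auto simp: nsets_0 pos_0)
next
  case (Suc n)
  let ?T = "\<lambda>n \<alpha>. {b \<in> nsets (Field r) n. \<forall>\<beta>\<in>b. less_in r \<alpha> \<beta>}"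
  have "slice n (?T (Suc n) \<alpha>) \<beta> \<in> pos n" if "less_in r \<alpha> \<beta>" for \<beta>
  proof -
    have "\<beta> \<in> Field r" using that less_in_Field by blast
    moreover have "?T n \<beta> \<subseteq> slice n (?T (Suc n) \<alpha>) \<beta>"
    proof
      fix b assume b: "b \<in> ?T n \<beta>"
      moreover have "\<beta> \<notin> b" using b less_in_asym by blast
      ultimately show "b \<in> slice n (?T (Suc n) \<alpha>) \<beta>"
        using that \<open>\<beta> \<in> Field r\<close> less_in_trans by (auto simp: slice_def nsets_def)
    qed
    moreover have "slice n (?T (Suc n) \<alpha>) \<beta> \<subseteq> nsets (Field r) n" by (auto simp: slice_def)
    ultimately show ?thesis using Suc.IH pos_mono by blast
  qed
  then have "{b. less_in r \<alpha> b} \<subseteq> {\<beta> \<in> Field r. slice n (?T (Suc n) \<alpha>) \<beta> \<in> pos n}"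
    using less_in_Field(2) by blast
  then show ?case using underS_compl_notin[OF Suc.prems] ideal_subset pos_Suc by blast
qed

lemma nsets_pos: "nsets (Field r) n \<in> pos n"
proof -
  obtain \<alpha> where "\<alpha> \<in> Field r" using infinite_Field by fastforce
  then show ?thesis using nsets_above_pos pos_mono by blast
qed

text \<open>
  \<open>fubini_power\<close> peels off the first coordinate of a tuple; here the last coordinate is peeled off.
\<close>

lemma pos_extensions:
  "X \<in> pos (Suc n) \<Longrightarrow> {a \<in> nsets (Field r) n. extensions X a \<notin> I} \<in> pos n"
proof (induction n arbitrary: X)
  case 0
  have "{\<alpha> \<in> Field r. slice 0 X \<alpha> \<in> pos 0} \<subseteq> extensions X {}"
    by (auto simp: extensions_def pos_0 slice_def)
  then show ?case using 0 ideal_subset by (auto simp: nsets_0 pos_Suc pos_0)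
next
  case (Suc n)
  let ?D = "\<lambda>n X. {a \<in> nsets (Field r) n. extensions X a \<notin> I}"
  have "slice n (?D (Suc n) X) \<alpha> \<in> pos n" if \<alpha>: "\<alpha> \<in> Field r" "slice (Suc n) X \<alpha> \<in> pos (Suc n)" for \<alpha>
  proof (rule pos_mono[OF Suc.IH[OF \<alpha>(2)]])
    show "?D n (slice (Suc n) X \<alpha>) \<subseteq> slice n (?D (Suc n) X) \<alpha>"
    proof
      fix b assume b: "b \<in> ?D n (slice (Suc n) X \<alpha>)"
      \<comment> \<open>A single extension of \<open>b\<close> inside the slice already shows that
        \<alpha> lies below all of \<open>b\<close>.\<close>
      then have "extensions (slice (Suc n) X \<alpha>) b \<noteq> {}" using ideal_empty by auto
      then have above: "\<forall>\<beta>\<in>b. less_in r \<alpha> \<beta>" by (auto simp: extensions_def slice_def)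
      then have "\<alpha> \<notin> b" using less_in_asym by blast
      then have "insert \<alpha> b \<in> nsets (Field r) (Suc n)" using b \<alpha> by (auto simp: nsets_def)
      moreover have "extensions (slice (Suc n) X \<alpha>) b \<subseteq> extensions X (insert \<alpha> b)"
        by (auto simp: extensions_def slice_def insert_commute)
      then have "extensions X (insert \<alpha> b) \<notin> I" using b ideal_subset by blast
      ultimately show "b \<in> slice n (?D (Suc n) X) \<alpha>" using b above by (auto simp: slice_def)
    qed
  qed (auto simp: slice_def)
  then have "{\<alpha> \<in> Field r. slice (Suc n) X \<alpha> \<in> pos (Suc n)}
      \<subseteq> {\<alpha> \<in> Field r. slice n (?D (Suc n) X) \<alpha> \<in> pos n}" by blast
  then show ?case using Suc.prems ideal_subset pos_Suc[of _ "Suc n"] pos_Suc[of _ n] by blast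
qed

section \<open>Joint extension from linkedness\<close>

text \<open>Linkedness for the sections of \<open>Z\<close>, with a finite set \<open>A\<close> in
  place of an indexed tuple and \<open>q\<close> as the common lower bound. That \<gamma> lies above
  \<open>a\<close> is left to \<open>admissible_value\<close>.\<close>

definition jointly_extendible :: "nat \<Rightarrow> 'a set set \<Rightarrow> 'a set set \<Rightarrow> bool" where
  "jointly_extendible m Y Z \<longleftrightarrow>
     (\<forall>A\<subseteq>Y. finite A \<and> card A \<le> m \<and> (\<forall>a\<in>A. \<forall>b\<in>A. same_type r a b) \<longrightarrow>
        (\<exists>q. q \<subseteq> Field r \<and> q \<notin> I \<and> (\<forall>a\<in>A. \<forall>\<gamma>\<in>q. insert \<gamma> a \<in> Z)))"

lemma linked_jointly_extendible:
  assumes linked: "linked r I n m (positive_sets (Field r) I) (\<subseteq>)" and X: "X \<in> pos (Suc n)"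
  shows "\<exists>Y\<in>pos n. jointly_extendible m Y X"
proof -
  let ?D = "{a \<in> nsets (Field r) n. extensions X a \<notin> I}"
  have ext: "extensions X \<in> ?D \<rightarrow> positive_sets (Field r) I"
    by (auto simp: positive_sets_def extensions_def)
  obtain Y where Y: "Y \<in> pos n" "Y \<subseteq> ?D" and
    link: "\<forall>k\<le>m. \<forall>a :: nat \<Rightarrow> 'a set.
      (\<forall>i<k. a i \<in> Y) \<and> (\<forall>i<k. \<forall>j<k. same_type r (a i) (a j)) \<longrightarrow>
      (\<exists>q\<in>positive_sets (Field r) I. \<forall>i<k. q \<subseteq> extensions X (a i))"
    using linked[unfolded linked_def, THEN bspec, OF pos_extensions[OF X, unfolded pos_def],
        THEN bspec, OF ext, folded pos_def] by (elim bexE conjE)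
  have "jointly_extendible m Y X"
    unfolding jointly_extendible_def
  proof (intro allI impI, elim conjE)
    fix A assume A: "A \<subseteq> Y" "finite A" "card A \<le> m" "\<forall>a\<in>A. \<forall>b\<in>A. same_type r a b"
    obtain h where "bij_betw h {0..<card A} A" using ex_bij_betw_nat_finite[OF A(2)] by blast
    then have h: "A = h ` {..<card A}" by (simp add: bij_betw_def lessThan_atLeast0)
    then have hA: "\<forall>i<card A. h i \<in> A" by blast
    then obtain q where q: "q \<in> positive_sets (Field r) I" "\<forall>i<card A. q \<subseteq> extensions X (h i)"
      using link[rule_format, OF A(3), of h] A(1,4) by blast
    then have "\<forall>a\<in>A. q \<subseteq> extensions X a" using h by (metis imageE lessThan_iff)
    then have "\<forall>a\<in>A. \<forall>\<gamma>\<in>q. insert \<gamma> a \<in> X" by (auto simp: extensions_def)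
    then show "\<exists>q. q \<subseteq> Field r \<and> q \<notin> I \<and> (\<forall>a\<in>A. \<forall>\<gamma>\<in>q. insert \<gamma> a \<in> X)"
      using q(1) by (auto simp: positive_sets_def)
  qed
  then show ?thesis using Y by blast
qed

text \<open>Built from the top down, one use of linkedness per level. The bottom is forced, since
  \<open>{{}}\<close> is the only positive set at level 0.\<close>

lemma ex_extendible_tower:
  assumes linked: "\<And>i. linked r I i m (positive_sets (Field r) I) (\<subseteq>)"
  shows "X \<in> pos n \<Longrightarrow>
    \<exists>Y. Y n = X \<and> Y 0 = {{}} \<and> (\<forall>i<n. jointly_extendible m (Y i) (Y (Suc i)))"
proof (induction n arbitrary: X)
  case 0
  then have "X = {{}}" by (simp add: pos_0)
  then show ?case by (intro exI[of _ "\<lambda>_. X"]) simp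
next
  case (Suc n)
  obtain Z where Z: "Z \<in> pos n" "jointly_extendible m Z X"
    using linked_jointly_extendible[OF linked Suc.prems] by blast
  then obtain Y where Y: "Y n = Z" "Y 0 = {{}}" "\<forall>i<n. jointly_extendible m (Y i) (Y (Suc i))"
    using Suc.IH by blast
  show ?case
    by (rule exI[of _ "Y(Suc n := X)"]) (use Y Z in \<open>auto simp: less_Suc_eq\<close>)
qed

end

section \<open>Types of chains, and flags\<close>

text \<open>The bijection matches equal indices. It fixes the intersection because, by
  \<open>position\<close>, a common value has the same index in both chains.\<close>

lemma same_type_strict_chains:
  fixes s t :: "nat \<Rightarrow> 'a"
  assumes s: "\<And>k l. k < l \<Longrightarrow> l < n \<Longrightarrow> less_in r (s k) (s l)"
    and t: "\<And>k l. k < l \<Longrightarrow> l < n \<Longrightarrow> less_in r (t k) (t l)"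
    and antisym: "antisym r"
    and position: "\<And>k l. k < n \<Longrightarrow> l < n \<Longrightarrow> s k = t l \<Longrightarrow> k = l"
  shows "same_type r (s ` {..<n}) (t ` {..<n})"
proof -
  have inj: "inj_on u {..<n}" if "\<And>k l. k < l \<Longrightarrow> l < n \<Longrightarrow> less_in r (u k) (u l)" for u :: "nat \<Rightarrow> 'a"
  proof (rule inj_onI)
    fix k l assume "k \<in> {..<n}" "l \<in> {..<n}" "u k = u l"
    then show "k = l" using that[of k l] that[of l k] by (cases k l rule: linorder_cases) (auto simp: underS_def)
  qed
  have inj_s: "inj_on s {..<n}" and inj_t: "inj_on t {..<n}" using inj[of s] inj[of t] s t by simp_all
  define f where "f = t \<circ> the_inv_into {..<n} s"
  have f: "f (s k) = t k" if "k < n" for k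
    using that inj_s by (simp add: f_def the_inv_into_f_f)
  have "bij_betw f (s ` {..<n}) (t ` {..<n})"
    unfolding f_def using inj_s inj_t
    by (intro bij_betw_trans[OF bij_betw_the_inv_into]) (auto simp: bij_betw_def)
  moreover have "monotone_on (s ` {..<n}) (less_in r) (less_in r) f"
  proof (rule monotone_onI)
    fix x y assume "x \<in> s ` {..<n}" "y \<in> s ` {..<n}" and xy: "less_in r x y"
    then obtain k l where kl: "k < n" "l < n" "x = s k" "y = s l" by auto
    have "k < l"
    proof (rule ccontr)
      assume "\<not> k < l"
      then have "l = k \<or> less_in r y x" using s kl by (auto simp: not_less le_less)
      then show False using xy kl antisym by (auto simp: underS_def antisym_def)
    qed
    then show "less_in r (f x) (f y)" using kl t f by auto
  qed
  moreover have "\<forall>x\<in>s ` {..<n} \<inter> t ` {..<n}. f x = x"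
    using position f by fastforce
  ultimately show ?thesis unfolding same_type_def by blast
qed

lemma star_eq_image: "star F \<sigma> = (\<lambda>i. F (\<sigma> ! i)) ` {..<length \<sigma>}"
  by (auto simp: star_def)

lemma star_snoc: "star F (\<sigma> @ [x]) = insert (F x) (star F \<sigma>)"
  by (auto simp: star_eq_image lessThan_Suc nth_append)

lemma flags_mono: "\<sigma> \<in> flags A n \<Longrightarrow> i \<le> j \<Longrightarrow> j < n \<Longrightarrow> \<sigma> ! i \<subseteq> \<sigma> ! j"
proof (induction j)
  case (Suc j)
  then show ?case by (cases "i = Suc j") (auto simp: flags_def)
qed simp

text \<open>The remaining members are regarded as a flag in the top set \<open>x\<close>, since the
  choice of F at \<open>x\<close> refers to flags of subsets of \<open>x\<close>.\<close>

lemma flags_SucE: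
  assumes "\<sigma> \<in> flags A (Suc n)"
  obtains \<tau> x where "\<sigma> = \<tau> @ [x]" "x \<in> nsets A (Suc n)" "\<tau> \<in> flags x n"
proof
  have len: "length \<sigma> = Suc n" using assms by (auto simp: flags_def)
  then show "\<sigma> = take n \<sigma> @ [\<sigma> ! n]" by (simp add: take_Suc_conv_app_nth[symmetric])
  show "\<sigma> ! n \<in> nsets A (Suc n)" using assms by (auto simp: flags_def)
  show "take n \<sigma> \<in> flags (\<sigma> ! n) n"
    using assms flags_mono[OF assms, of _ n] unfolding flags_def
    by (auto simp: nsets_def less_Suc_eq)
qed

lemma flags_nth:
  assumes "\<sigma> \<in> flags x n" "i < n"
  shows "\<sigma> ! i \<subseteq> x" "finite (\<sigma> ! i)" "card (\<sigma> ! i) = Suc i"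
  using assms by (auto simp: flags_def nsets_def)

section \<open>The well-founded order of the recursion\<close>

context normal_uniform_ideal
begin

text \<open>Including the least element makes the maximum of the empty set meaningful.\<close>

definition max_el :: "'a set \<Rightarrow> 'a" where
  "max_el x = (SOME w. w \<in> insert least_el x \<and> (\<forall>z\<in>insert least_el x. (z, w) \<in> r))"

lemma max_el:
  assumes "x \<in> nsets_le (Field r) N"
  shows "max_el x \<in> insert least_el x" "z \<in> insert least_el x \<Longrightarrow> (z, max_el x) \<in> r"
    "max_el x \<in> Field r"
proof -
  have "finite (insert least_el x)" "insert least_el x \<subseteq> Field r"
    using assms least_el by (auto simp: nsets_le_def)
  then have "\<exists>w. w \<in> insert least_el x \<and> (\<forall>z\<in>insert least_el x. (z, w) \<in> r)"
    using ex_max[of "insert least_el x"] by blast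
  then have w: "max_el x \<in> insert least_el x \<and> (\<forall>z\<in>insert least_el x. (z, max_el x) \<in> r)"
    unfolding max_el_def by (rule someI_ex)
  then show "max_el x \<in> insert least_el x" "z \<in> insert least_el x \<Longrightarrow> (z, max_el x) \<in> r"
    by blast+
  show "max_el x \<in> Field r" using w \<open>insert least_el x \<subseteq> Field r\<close> by blast
qed

text \<open>Three features motivate this order: proper subsets come earlier, sets of different sizes
  are comparable, and all predecessors of \<open>x\<close> lie in the small set
  \<open>under r (max_el x)\<close>.\<close>

definition before :: "'a set rel" where
  "before = inv_image ((r - Id) <*lex*> less_than) (\<lambda>x. (max_el x, card x))"

lemma wf_before: "wf before"
  unfolding before_def by (intro wf_inv_image wf_lex_prod wf_strict wf_less_than)

lemma before_iff:
  "(y, x) \<in> before \<longleftrightarrow> less_in r (max_el y) (max_el x) \<or> max_el y = max_el x \<and> card y < card x"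
  by (auto simp: before_def underS_def)

lemma psubset_before:
  assumes "x \<in> nsets_le (Field r) N" "y \<subset> x"
  shows "(y, x) \<in> before" "y \<in> nsets_le (Field r) N"
proof -
  have fin: "finite x" using assms by (simp add: nsets_le_def)
  have card: "card y < card x" using psubset_card_mono[OF fin assms(2)] .
  show y: "y \<in> nsets_le (Field r) N"
    using assms card fin by (auto simp: nsets_le_def intro: finite_subset)
  have "(max_el y, max_el x) \<in> r"
    using max_el(1)[OF y] max_el(2)[OF assms(1)] assms(2) by blast
  then show "(y, x) \<in> before" using card by (auto simp: before_iff underS_def)
qed

text \<open>Since F will increase along \<open>before\<close>, this separates its values at sets of
  different sizes, as \<open>position\<close> in \<open>same_type_strict_chains\<close>
  demands.\<close>

lemma before_total:
  assumes "x \<in> nsets_le (Field r) N" "y \<in> nsets_le (Field r) N" "card x \<noteq> card y"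
  shows "(x, y) \<in> before \<or> (y, x) \<in> before"
  using less_in_total[OF max_el(3)[OF assms(1)] max_el(3)[OF assms(2)]] assms(3)
  by (auto simp: before_iff)

lemma before_nsets_le_under:
  assumes "x \<in> nsets_le (Field r) N" "y \<in> nsets_le (Field r) N" "(y, x) \<in> before"
  shows "y \<in> nsets_le (under r (max_el x)) N"
proof -
  have "(max_el y, max_el x) \<in> r"
    using assms(3) refl_onD[OF wo_rel.REFL[OF wo_rel] max_el(3)[OF assms(1)]]
    by (auto simp: before_iff underS_def)
  then have "z \<in> under r (max_el x)" if "z \<in> y" for z
    using max_el(2)[OF assms(2), of z] that wo_rel.TRANS[OF wo_rel]
    by (auto simp: under_def dest: transD)
  then show ?thesis using assms(2) by (auto simp: nsets_le_def)
qed

lemma not_under_less_in: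
  assumes "a \<in> Field r" "b \<in> Field r" "b \<notin> under r a" shows "less_in r a b"
  using less_in_total[OF assms(1,2)] rel_refl[OF assms(1)] assms(3)
  by (auto simp: under_def underS_def)

section \<open>Choosing the value of F at a set\<close>

text \<open>The third clause concerns all predecessors of \<open>x\<close>, not only its subsets, so
  that values at sets of different sizes differ. In the last clause the flag has length one less
  than the size of \<open>x\<close>, so its members are proper subsets; for empty \<open>x\<close>
  the clause is void.\<close>

definition admissible_value :: "nat \<Rightarrow> (nat \<Rightarrow> 'a set set) \<Rightarrow> ('a set \<Rightarrow> 'a) \<Rightarrow> 'a set \<Rightarrow> 'a \<Rightarrow> bool" where
  "admissible_value N Y F x \<gamma> \<longleftrightarrow>
     \<gamma> \<in> Field r \<and> (\<forall>a\<in>x. less_in r a \<gamma>) \<and>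
     (\<forall>y\<in>nsets_le (Field r) N. (y, x) \<in> before \<longrightarrow> less_in r (F y) \<gamma>) \<and>
     (\<forall>i \<sigma>. card x = Suc i \<and> \<sigma> \<in> flags x i \<longrightarrow> insert \<gamma> (star F \<sigma>) \<in> Y (Suc i))"

lemma flags_nth_psubset:
  assumes "\<sigma> \<in> flags x i" "card x = Suc i" "k < i"
  shows "\<sigma> ! k \<subset> x"
  using flags_nth[OF assms(1,3)] assms(2,3) by (metis Suc_inject less_irrefl psubsetI)

text \<open>Admissibility looks at F only at predecessors of \<open>x\<close>, which is what
  well-founded dependent choice requires.\<close>

lemma admissible_value_cong:
  assumes x: "x \<in> nsets_le (Field r) N" and FG: "\<And>y. (y, x) \<in> before \<Longrightarrow> F y = G y"
  shows "admissible_value N Y F x \<gamma> = admissible_value N Y G x \<gamma>"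
proof -
  have "star F \<sigma> = star G \<sigma>" if "\<sigma> \<in> flags x i" "card x = Suc i" for \<sigma> i
    unfolding star_eq_image
  proof (rule image_cong[OF refl])
    fix k assume "k \<in> {..<length \<sigma>}"
    then have "k < i" using that by (simp add: flags_def)
    then show "F (\<sigma> ! k) = G (\<sigma> ! k)"
      using FG psubset_before(1)[OF x] flags_nth_psubset[OF that] by blast
  qed
  then show ?thesis using FG by (auto simp: admissible_value_def)
qed

text \<open>Joint extendibility gives a positive set \<open>q\<close> of candidates meeting the flag
  clause. The candidates violating an order clause form a set in \<open>I\<close>, so one candidate
  survives.\<close>

lemma ex_admissible_value:
  assumes Y0: "Y 0 = {{}}"
    and ext: "\<And>i. i < N \<Longrightarrow> jointly_extendible (2 ^ 2 ^ N) (Y i) (Y (Suc i))"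
    and x: "x \<in> nsets_le (Field r) N"
    and F: "\<And>y. y \<in> nsets_le (Field r) N \<Longrightarrow> (y, x) \<in> before \<Longrightarrow> admissible_value N Y F y (F y)"
  shows "\<exists>\<gamma>. admissible_value N Y F x \<gamma>"
proof -
  have F_psubset: "admissible_value N Y F y (F y)" if "y \<subset> x" for y
    using F psubset_before[OF x that] by blast
  have F_less: "less_in r (F u) (F v)"
    if "u \<in> nsets_le (Field r) N" "v \<subset> x" "(u, v) \<in> before" for u v
    using F_psubset[OF that(2)] that(1,3) by (auto simp: admissible_value_def)
  have F_neq: "F u \<noteq> F v" if uv: "u \<subset> x" "v \<subset> x" "card u \<noteq> card v" for u v
  proof -
    have "(u, v) \<in> before \<or> (v, u) \<in> before"
      using before_total psubset_before(2)[OF x] uv by blast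
    then have "less_in r (F u) (F v) \<or> less_in r (F v) (F u)"
      using F_less psubset_before(2)[OF x] uv by blast
    then show ?thesis by (auto simp: underS_def)
  qed
  have "\<exists>q. q \<subseteq> Field r \<and> q \<notin> I \<and>
      (\<forall>i \<sigma> \<gamma>. card x = Suc i \<and> \<sigma> \<in> flags x i \<and> \<gamma> \<in> q \<longrightarrow> insert \<gamma> (star F \<sigma>) \<in> Y (Suc i))"
  proof (cases "card x")
    case 0
    \<comment> \<open>No flag condition arises for empty \<open>x\<close>, so the whole field serves
      as \<open>q\<close>.\<close>
    then show ?thesis using Field_notin_ideal by auto
  next
    case (Suc i)
    then have i: "i < N" using x by (simp add: nsets_le_def)
    have fin: "finite x" using x by (simp add: nsets_le_def)
    define A where "A = star F ` flags x i"
    \<comment> \<open>For nonempty \<sigma> this is the flag clause at the top member of \<sigma>, a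
      proper subset of \<open>x\<close>; the empty flag uses \<open>Y 0 = {{}}\<close>.\<close>
    have "star F \<sigma> \<in> Y i" if \<sigma>: "\<sigma> \<in> flags x i" for \<sigma>
    proof (cases i)
      case 0
      then show ?thesis using \<sigma> Y0 by (simp add: flags_def star_def)
    next
      case j: (Suc j)
      obtain \<tau> z where z: "\<sigma> = \<tau> @ [z]" "z \<in> nsets x (Suc j)" "\<tau> \<in> flags z j"
        using \<sigma> flags_SucE unfolding j by metis
      then have "z \<subset> x" using Suc j by (auto simp: nsets_def)
      then show ?thesis using F_psubset z j by (auto simp: admissible_value_def star_snoc nsets_def)
    qed
    then have AY: "A \<subseteq> Y i" by (auto simp: A_def)
    have sub: "A \<subseteq> Pow (F ` Pow x)"
    proof -
      have "star F \<sigma> \<subseteq> F ` Pow x" if \<sigma>: "\<sigma> \<in> flags x i" for \<sigma>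
        using flags_nth(1)[OF \<sigma>] \<sigma> unfolding star_eq_image by (auto simp: flags_def)
      then show ?thesis unfolding A_def by blast
    qed
    then have "finite A" using fin by (meson finite_Pow_iff finite_imageI finite_subset)
    \<comment> \<open>Source of the double exponential: each member of \<open>A\<close> is a set of
      values of F at subsets of \<open>x\<close>.\<close>
    have "card (F ` Pow x) \<le> 2 ^ N"
    proof -
      have "card (F ` Pow x) \<le> 2 ^ card x"
        using card_image_le[of "Pow x" F] fin by (simp add: card_Pow)
      also have "\<dots> \<le> 2 ^ N" using x by (simp add: nsets_le_def)
      finally show ?thesis .
    qed
    then have "(2::nat) ^ card (F ` Pow x) \<le> 2 ^ 2 ^ N" by (intro power_increasing) auto
    moreover have "card A \<le> 2 ^ card (F ` Pow x)"
      using card_mono[OF _ sub] fin by (simp add: card_Pow)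
    ultimately have "card A \<le> 2 ^ 2 ^ N" by (rule order.trans[rotated])
    moreover have "same_type r (star F \<sigma>) (star F \<tau>)"
      if \<sigma>: "\<sigma> \<in> flags x i" and \<tau>: "\<tau> \<in> flags x i" for \<sigma> \<tau>
    proof -
      have chain: "less_in r (F (\<rho> ! k)) (F (\<rho> ! l))" if "\<rho> \<in> flags x i" "k < l" "l < i" for \<rho> k l
      proof -
        have sub: "\<rho> ! k \<subset> x" "\<rho> ! l \<subset> x"
          using flags_nth_psubset[OF that(1) Suc] that(2,3) by simp_all
        have "\<rho> ! k \<noteq> \<rho> ! l"
          using flags_nth(3)[OF that(1), of k] flags_nth(3)[OF that(1), of l] that(2,3) by auto
        then have "\<rho> ! k \<subset> \<rho> ! l" using flags_mono[OF that(1), of k l] that by auto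
        then show ?thesis
          by (intro F_less psubset_before(2)[OF x sub(1)] sub(2)
              psubset_before(1)[OF psubset_before(2)[OF x sub(2)]])
      qed
      have len: "length \<sigma> = i" "length \<tau> = i" using \<sigma> \<tau> by (auto simp: flags_def)
      show ?thesis
        unfolding star_eq_image len
      proof (rule same_type_strict_chains)
        show "antisym r" by (rule wo_rel.ANTISYM[OF wo_rel])
        show "k = l" if "k < i" "l < i" "F (\<sigma> ! k) = F (\<tau> ! l)" for k l
          using F_neq[of "\<sigma> ! k" "\<tau> ! l"] that flags_nth(3)[OF \<sigma>, of k] flags_nth(3)[OF \<tau>, of l]
            flags_nth_psubset[OF \<sigma> Suc] flags_nth_psubset[OF \<tau> Suc] by auto
      qed (simp_all add: chain \<sigma> \<tau>)
    qed
    then have "\<forall>a\<in>A. \<forall>b\<in>A. same_type r a b" by (auto simp: A_def)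
    ultimately have "\<exists>q. q \<subseteq> Field r \<and> q \<notin> I \<and> (\<forall>a\<in>A. \<forall>\<gamma>\<in>q. insert \<gamma> a \<in> Y (Suc i))"
      using \<open>finite A\<close>
      by (intro ext[OF i, unfolded jointly_extendible_def, THEN spec, THEN mp, THEN mp, OF AY] conjI)
    then obtain q where "q \<subseteq> Field r" "q \<notin> I" "\<forall>a\<in>A. \<forall>\<gamma>\<in>q. insert \<gamma> a \<in> Y (Suc i)"
      by blast
    then show ?thesis using Suc by (intro exI[of _ q]) (auto simp: A_def)
  qed
  then obtain q where q: "q \<subseteq> Field r" "q \<notin> I"
    "\<And>i \<sigma> \<gamma>. card x = Suc i \<Longrightarrow> \<sigma> \<in> flags x i \<Longrightarrow> \<gamma> \<in> q \<Longrightarrow> insert \<gamma> (star F \<sigma>) \<in> Y (Suc i)"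
    by blast
  \<comment> \<open>Collects the points not above \<open>F y\<close>. The empty default lets
    \<open>y\<close> range over all small subsets of \<open>under r (max_el x)\<close>, as
    \<open>UN_nsets_le\<close> expects.\<close>
  define B where
    "B y = (if y \<in> nsets_le (Field r) N \<and> (y, x) \<in> before then under r (F y) else {})" for y
  have F_Field: "F y \<in> Field r" if "y \<in> nsets_le (Field r) N" "(y, x) \<in> before" for y
    using F[OF that] by (simp add: admissible_value_def)
  have "(\<Union>y\<in>nsets_le (under r (max_el x)) N. B y) \<in> I"
    by (rule UN_nsets_le[OF max_el(3)[OF x]]) (simp add: B_def under_in F_Field ideal_empty)
  then have "under r (max_el x) \<union> (\<Union>y\<in>nsets_le (under r (max_el x)) N. B y) \<in> I"
    using ideal_Un under_in max_el(3)[OF x] by blast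
  then obtain \<gamma> where \<gamma>: "\<gamma> \<in> q" "\<gamma> \<notin> under r (max_el x)"
    "\<gamma> \<notin> (\<Union>y\<in>nsets_le (under r (max_el x)) N. B y)"
    using q(2) ideal_subset by blast
  have \<gamma>F: "\<gamma> \<in> Field r" using \<gamma> q by blast
  have max_less: "less_in r (max_el x) \<gamma>" using not_under_less_in max_el(3)[OF x] \<gamma>F \<gamma>(2) by blast
  have "less_in r a \<gamma>" if "a \<in> x" for a
    using max_el(2)[OF x, of a] that max_less less_in_trans[of a "max_el x" \<gamma>]
    by (cases "a = max_el x") (auto simp: underS_def)
  moreover have "less_in r (F y) \<gamma>" if y: "y \<in> nsets_le (Field r) N" "(y, x) \<in> before" for y
  proof (rule not_under_less_in[OF F_Field[OF y] \<gamma>F])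
    show "\<gamma> \<notin> under r (F y)"
      using \<gamma>(3) before_nsets_le_under[OF x y] y by (auto simp: B_def)
  qed
  ultimately show ?thesis
    using \<gamma>F q(3) \<gamma>(1) unfolding admissible_value_def by blast
qed

section \<open>The homogeneous cofinal function\<close>

lemma PH:
  assumes linked: "\<And>n m. linked r I n m (positive_sets (Field r) I) (\<subseteq>)"
  shows "PH n r"
  unfolding PH_def
proof
  fix c :: "'a set \<Rightarrow> nat"
  let ?N = "Suc n"
  let ?Z = "\<lambda>d. {a \<in> nsets (Field r) ?N. c a = d}"
  \<comment> \<open>The colour classes form a countable cover of a positive set.\<close>
  have "\<exists>d. ?Z d \<in> pos ?N"
    by (rule pos_countable_cover[OF nsets_pos]) auto
  then obtain d where Z: "?Z d \<in> pos ?N" by blast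
  obtain Y where Y: "Y ?N = ?Z d" "Y 0 = {{}}"
    and ext: "\<forall>i<?N. jointly_extendible (2 ^ 2 ^ ?N) (Y i) (Y (Suc i))"
    using ex_extendible_tower[OF linked Z, of "2 ^ 2 ^ ?N"] by (elim exE conjE)
  have "\<exists>F. \<forall>x. x \<in> nsets_le (Field r) ?N \<longrightarrow> admissible_value ?N Y F x (F x)"
  proof (rule dependent_wf_choice[OF wf_before])
    show "\<exists>\<gamma>. x \<in> nsets_le (Field r) ?N \<longrightarrow> admissible_value ?N Y F x \<gamma>"
      if "\<And>y. (y, x) \<in> before \<Longrightarrow> y \<in> nsets_le (Field r) ?N \<longrightarrow> admissible_value ?N Y F y (F y)"
      for x F
      using ex_admissible_value[of Y ?N x F] Y(2) ext that by simp
  qed (use admissible_value_cong in blast)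
  then obtain F where F: "\<And>x. x \<in> nsets_le (Field r) ?N \<Longrightarrow> admissible_value ?N Y F x (F x)"
    by blast
  have "cofinal_fun r (n + 1) F"
    unfolding cofinal_fun_def
  proof (intro conjI ballI impI)
    show "F \<in> nsets_le (Field r) (n + 1) \<rightarrow> Field r"
      using F by (auto simp: admissible_value_def)
    show "less_in r \<alpha> (F {\<alpha>})" if "\<alpha> \<in> Field r" for \<alpha>
      using F[of "{\<alpha>}"] that by (auto simp: admissible_value_def nsets_le_def)
    show "less_in r (F x) (F y)"
      if "x \<in> nsets_le (Field r) (n + 1)" "y \<in> nsets_le (Field r) (n + 1)" "x \<subset> y" for x y
      using F[of y] that psubset_before(1)[of y ?N x] by (simp add: admissible_value_def)
  qed
  moreover have "c (star F \<sigma>) = d" if \<sigma>: "\<sigma> \<in> flags (Field r) (n + 1)" for \<sigma>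
  proof -
    \<comment> \<open>The flag clause at the top member \<open>x\<close>, of size
      \<open>n + 1\<close>, places the image in the last level of the tower, which is the colour
      class.\<close>
    obtain \<tau> x where x: "\<sigma> = \<tau> @ [x]" "x \<in> nsets (Field r) ?N" "\<tau> \<in> flags x n"
      using \<sigma> flags_SucE[of \<sigma> "Field r" n] by auto
    then have "admissible_value ?N Y F x (F x)" by (intro F) (auto simp: nsets_def nsets_le_def)
    then have "star F \<sigma> \<in> Y ?N" using x by (auto simp: admissible_value_def star_snoc nsets_def)
    then show ?thesis using Y(1) by simp
  qed
  ultimately show "\<exists>F. cofinal_fun r (n + 1) F \<and> (\<exists>d. \<forall>\<sigma>\<in>flags (Field r) (n + 1). c (star F \<sigma>) = d)"
    by blast
qed

end

theorem theorem4p10: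
  fixes \<kappa> :: "'a rel" and I :: "'a set set"
  assumes "Card_order \<kappa>" and "infinite (Field \<kappa>)"
    and "proper_ideal_on (Field \<kappa>) I"
    and "uniform_ideal \<kappa> I"
    and "normal_ideal \<kappa> I"
    and "\<forall>n m. linked \<kappa> I n m (positive_sets (Field \<kappa>) I) (\<subseteq>)"
  shows "\<forall>n. PH n \<kappa>"
proof -
  interpret normal_uniform_ideal \<kappa> I
    using assms(1-5) by unfold_locales
  show ?thesis using PH assms(6) by blast
qed

end
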